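(* Let $(H;\langle\cdot,\cdot\rangle)$ be an inner product space over the real or complex number field $\mathbb{K}$, let $x_i\in H$ for $i\in\{1,\dots,n\}$, and let $M\ge m>0$ be such that either $$\operatorname{Re}\langle Mx_j-x_i,\,x_i-mx_j\rangle\ge0\qquad\text{for }1\le i<j\le n,$$ or, equivalently, $$\Big\|x_i-\frac{M+m}{2}x_j\Big\|\le\frac12(M-m)\|x_j\|\qquad\text{for }1\le i<j\le n.$$ Then $$\frac{2\sqrt{mM}}{M+m}\Big(\sum_{i=1}^n\|x_i\|\Big)^2+\frac{(\sqrt M-\sqrt m)^2}{M+m}\sum_{i=1}^n\|x_i\|^2\le\Big\|\sum_{i=1}^n x_i\Big\|^2.$$ Equality holds in this last inequality if and only if $$\|x_i\|\,\|x_j\|=\frac{M+m}{2\sqrt{mM}}\operatorname{Re}\langle x_i,x_j\rangle\qquad\text{for }1\le i<j\le n.$$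
   Context: $n$ is a positive integer and $\|\cdot\|$ is the norm induced by the inner product. *)

theory Defs
  imports Complex_Main "HOL-Analysis.Inner_Product"
begin

text \<open>The scalar fields \<open>\<real>\<close> and \<open>\<complex>\<close>, treated uniformly: a field that is a real algebra and has an
  \<open>\<real>\<close>-algebra homomorphism into \<open>\<complex>\<close>. By the lemmas \<open>inj_to_complex\<close> and \<open>range_to_complex\<close>
  below, every instance is (through \<open>to_complex\<close>) a copy of \<open>\<real>\<close> or of \<open>\<complex>\<close>.\<close>

class real_or_complex = real_field +
  fixes to_complex :: "'a \<Rightarrow> complex"
  assumes to_complex_add: "to_complex (a + b) = to_complex a + to_complex b"
    and to_complex_mult: "to_complex (a * b) = to_complex a * to_complex b"
    and to_complex_scaleR: "to_complex (r *\<^sub>R a) = r *\<^sub>R to_complex a"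
    and to_complex_one: "to_complex 1 = 1"

lemma to_complex_of_real: "to_complex (of_real r) = complex_of_real r"
  by (simp add: of_real_def to_complex_scaleR to_complex_one)

instantiation real :: real_or_complex
begin
definition to_complex_real :: "real \<Rightarrow> complex" where "to_complex_real r = complex_of_real r"
instance by standard (simp_all add: to_complex_real_def scaleR_conv_of_real)
end

instantiation complex :: real_or_complex
begin
definition to_complex_complex :: "complex \<Rightarrow> complex" where "to_complex_complex z = z"
instance by standard (simp_all add: to_complex_complex_def)
end

lemma inj_to_complex: "inj (to_complex :: 'k::real_or_complex \<Rightarrow> complex)"
proof (rule injI)
  fix a b :: 'k
  assume eq: "to_complex a = to_complex b"
  have "to_complex (a - b) + to_complex b = to_complex a"
    using to_complex_add[of "a - b" b] by simp
  with eq have z: "to_complex (a - b) = 0" by simp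
  show "a = b"
  proof (rule ccontr)
    assume "a \<noteq> b"
    then have "(a - b) * inverse (a - b) = of_real 1" by simp
    then have "to_complex (a - b) * to_complex (inverse (a - b)) = 1"
      by (metis to_complex_mult to_complex_of_real of_real_1)
    with z show False by simp
  qed
qed

lemma range_to_complex:
  "range (to_complex :: 'k::real_or_complex \<Rightarrow> complex) = \<real> \<or>
   range (to_complex :: 'k \<Rightarrow> complex) = UNIV"
proof (cases "range (to_complex :: 'k \<Rightarrow> complex) \<subseteq> \<real>")
  case True
  have "\<real> \<subseteq> range (to_complex :: 'k \<Rightarrow> complex)"
  proof
    fix z :: complex
    assume "z \<in> \<real>"
    then obtain r where "z = complex_of_real r" by (auto elim: Reals_cases)
    then show "z \<in> range (to_complex :: 'k \<Rightarrow> complex)"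
      by (metis rangeI to_complex_of_real)
  qed
  with True show ?thesis by blast
next
  case False
  then have "\<exists>k::'k. Im (to_complex k) \<noteq> 0"
    by (auto simp: complex_is_Real_iff)
  then obtain k :: 'k where k: "Im (to_complex k) \<noteq> 0" by blast
  have "z \<in> range (to_complex :: 'k \<Rightarrow> complex)" for z
  proof -
    define s where "s = Im z / Im (to_complex k)"
    define r where "r = Re z - s * Re (to_complex k)"
    have "to_complex (of_real r + of_real s * k)
        = complex_of_real r + complex_of_real s * to_complex k"
      by (simp add: to_complex_add to_complex_mult to_complex_of_real)
    also have "\<dots> = z"
      using k by (simp add: complex_eq_iff r_def s_def)
    finally have "to_complex (of_real r + of_real s * k) = z" .
    then show ?thesis by (metis rangeI)
  qed
  then show ?thesis by blast
qed

text \<open>Linearity is in the first argument. Conjugate symmetry makes \<open>ip x x\<close> real, so positivity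
  need only mention its real part.\<close>

locale inner_product_space = vector_space scale
  for scale :: "'k::real_or_complex \<Rightarrow> 'h::ab_group_add \<Rightarrow> 'h" +
  fixes ip :: "'h \<Rightarrow> 'h \<Rightarrow> 'k"
  assumes ip_add_left: "ip (x + y) z = ip x z + ip y z"
    and ip_scale_left: "ip (scale c x) z = c * ip x z"
    and ip_conj_sym: "to_complex (ip y x) = cnj (to_complex (ip x y))"
    and ip_pos: "x \<noteq> 0 \<Longrightarrow> Re (to_complex (ip x x)) > 0"

definition Re_ip :: "('h \<Rightarrow> 'h \<Rightarrow> 'k::real_or_complex) \<Rightarrow> 'h \<Rightarrow> 'h \<Rightarrow> real" where
  "Re_ip ip x y = Re (to_complex (ip x y))"

definition ip_norm :: "('h \<Rightarrow> 'h \<Rightarrow> 'k::real_or_complex) \<Rightarrow> 'h \<Rightarrow> real" where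
  "ip_norm ip x = sqrt (Re_ip ip x x)"

lemma inner_product_space_real_inner:
  "inner_product_space (scaleR :: real \<Rightarrow> 'a::real_inner \<Rightarrow> 'a) inner"
  by unfold_locales
    (simp_all add: to_complex_real_def inner_commute algebra_simps)

lemma ip_norm_real_inner: "ip_norm inner (x :: 'a::real_inner) = norm x"
  by (simp add: ip_norm_def Re_ip_def to_complex_real_def norm_eq_sqrt_inner)

lemma inner_product_space_complex:
  "inner_product_space ((*) :: complex \<Rightarrow> complex \<Rightarrow> complex) (\<lambda>x y. x * cnj y)"
proof unfold_locales
  fix x :: complex
  assume "x \<noteq> 0"
  then show "Re (to_complex (x * cnj x)) > 0"
    by (simp add: to_complex_complex_def complex_mult_cnj complex_neq_0)
qed (simp_all add: to_complex_complex_def algebra_simps)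

end

theory Submission imports Defs begin

text \<open>Write \<open>N i\<close> for the norm of \<open>x i\<close>, \<open>R i j\<close> for the real part of the inner product of \<open>x i\<close> and
  \<open>x j\<close>, and \<open>c = 2 * sqrt (m * M) / (M + m)\<close>. By bilinearity of \<open>R\<close>, both forms of the hypothesis on a
  pair \<open>i < j\<close> say that \<open>(N i)\<^sup>2 + m * M * (N j)\<^sup>2 \<le> (M + m) * R i j\<close>
  (lemmas \<open>Re_ip_nonneg_iff\<close> and \<open>ip_norm_le_iff\<close>). The arithmetic-geometric mean inequality then
  yields the reverse Cauchy-Schwarz inequality \<open>c * (N i * N j) \<le> R i j\<close>
  (lemma \<open>reverse_Cauchy_Schwarz\<close>).

  The theorem is the sum of these inequalities. The second coefficient
  \<open>(sqrt M - sqrt m)\<^sup>2 / (M + m)\<close> is exactly \<open>1 - c\<close>, which makes the diagonal terms cancel when both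
  squared sums are expanded: the right-hand side minus the left-hand side is
  \<open>2 * (\<Sum>i<j. R i j - c * (N i * N j))\<close>. All these terms are nonnegative, so the difference is
  nonnegative, and it vanishes precisely when every term does.\<close>

context inner_product_space
begin

text \<open>Only the real part of the inner product enters the argument. It is a symmetric positive
  semidefinite bilinear form over the reals, whatever the scalar field is.\<close>

lemma Re_ip_commute: "Re_ip ip u v = Re_ip ip v u"
  using ip_conj_sym[of u v] by (simp add: Re_ip_def)

lemma Re_ip_add_left: "Re_ip ip (u + v) w = Re_ip ip u w + Re_ip ip v w"
  by (simp add: Re_ip_def ip_add_left to_complex_add)

lemma Re_ip_add_right: "Re_ip ip u (v + w) = Re_ip ip u v + Re_ip ip u w"
  by (metis Re_ip_add_left Re_ip_commute)

lemma Re_ip_scale_left: "Re_ip ip (scale (of_real r) u) v = r * Re_ip ip u v"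
  by (simp add: Re_ip_def ip_scale_left to_complex_mult to_complex_of_real)

lemma Re_ip_scale_right: "Re_ip ip u (scale (of_real r) v) = r * Re_ip ip u v"
  by (metis Re_ip_scale_left Re_ip_commute)

lemma Re_ip_diff_left: "Re_ip ip (u - v) w = Re_ip ip u w - Re_ip ip v w"
  using Re_ip_add_left[of "u - v" v w] by simp

lemma Re_ip_diff_right: "Re_ip ip u (v - w) = Re_ip ip u v - Re_ip ip u w"
  by (metis Re_ip_diff_left Re_ip_commute)

lemma Re_ip_zero_left: "Re_ip ip 0 u = 0"
  using Re_ip_diff_left[of u u u] by simp

lemma Re_ip_sum_left: "Re_ip ip (sum f A) u = (\<Sum>i\<in>A. Re_ip ip (f i) u)"
  by (induction A rule: infinite_finite_induct) (simp_all add: Re_ip_zero_left Re_ip_add_left)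

lemma Re_ip_sum_right: "Re_ip ip u (sum f A) = (\<Sum>i\<in>A. Re_ip ip u (f i))"
  by (simp add: Re_ip_commute[of u] Re_ip_sum_left)

lemma Re_ip_self_nonneg: "0 \<le> Re_ip ip u u"
proof (cases "u = 0")
  case True
  then show ?thesis by (simp add: Re_ip_zero_left)
next
  case False
  then show ?thesis using ip_pos[of u] by (simp add: Re_ip_def)
qed

lemma ip_norm_nonneg: "0 \<le> ip_norm ip u"
  by (simp add: ip_norm_def Re_ip_self_nonneg)

lemma ip_norm_square: "(ip_norm ip u)\<^sup>2 = Re_ip ip u u"
  by (simp add: ip_norm_def Re_ip_self_nonneg)

lemma Re_ip_nonneg_iff:
  "0 \<le> Re_ip ip (scale (of_real M) v - u) (u - scale (of_real m) v)
    \<longleftrightarrow> (ip_norm ip u)\<^sup>2 + m * M * (ip_norm ip v)\<^sup>2 \<le> (M + m) * Re_ip ip u v"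
  by (simp add: Re_ip_diff_left Re_ip_diff_right Re_ip_scale_left Re_ip_scale_right
      ip_norm_square Re_ip_commute[of v u] algebra_simps)

text \<open>The ball centred at \<open>(M + m) / 2\<close> times \<open>v\<close> has the segment from \<open>m v\<close> to \<open>M v\<close> as a diameter, so
  this is the same condition as in \<open>Re_ip_nonneg_iff\<close>: completing the square uses
  \<open>((M + m) / 2)\<^sup>2 - ((M - m) / 2)\<^sup>2 = m * M\<close>.\<close>

lemma ip_norm_le_iff:
  assumes "m \<le> M"
  shows "ip_norm ip (u - scale (of_real ((M + m) / 2)) v) \<le> 1 / 2 * (M - m) * ip_norm ip v
    \<longleftrightarrow> (ip_norm ip u)\<^sup>2 + m * M * (ip_norm ip v)\<^sup>2 \<le> (M + m) * Re_ip ip u v"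
    (is "?l \<le> ?r \<longleftrightarrow> ?rhs")
proof -
  define s where "s = (M + m) / 2"
  have two_s: "2 * s = M + m" by (simp add: s_def)
  have l: "?l\<^sup>2 = (ip_norm ip u)\<^sup>2 - 2 * s * Re_ip ip u v + s\<^sup>2 * (ip_norm ip v)\<^sup>2"
    unfolding s_def[symmetric] ip_norm_square
    by (simp add: Re_ip_diff_left Re_ip_diff_right Re_ip_scale_left
        Re_ip_scale_right Re_ip_commute[of v u] power2_eq_square[of s] algebra_simps)
  have "0 \<le> ?r" using assms by (simp add: ip_norm_nonneg)
  then have "?l \<le> ?r \<longleftrightarrow> ?l\<^sup>2 \<le> ?r\<^sup>2"
    by (simp add: ip_norm_nonneg power2_le_iff_abs_le)
  also have "?r\<^sup>2 = (s\<^sup>2 - m * M) * (ip_norm ip v)\<^sup>2"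
    unfolding s_def by (simp add: power2_eq_square field_simps)
  also have "?l\<^sup>2 \<le> (s\<^sup>2 - m * M) * (ip_norm ip v)\<^sup>2 \<longleftrightarrow> ?rhs"
    unfolding l by (auto simp: left_diff_distrib two_s)
  finally show ?thesis .
qed

text \<open>This is the arithmetic-geometric mean inequality for \<open>(ip_norm ip u)\<^sup>2\<close> and
  \<open>m * M * (ip_norm ip v)\<^sup>2\<close>, whose geometric mean is \<open>sqrt (m * M)\<close> times the product of the norms.\<close>

lemma reverse_Cauchy_Schwarz:
  assumes "0 < m" "0 < M"
    and le: "(ip_norm ip u)\<^sup>2 + m * M * (ip_norm ip v)\<^sup>2 \<le> (M + m) * Re_ip ip u v"
  shows "2 * sqrt (m * M) / (M + m) * (ip_norm ip u * ip_norm ip v) \<le> Re_ip ip u v"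
proof -
  have "0 \<le> (ip_norm ip u - sqrt (m * M) * ip_norm ip v)\<^sup>2" by simp
  also have "\<dots> = (ip_norm ip u)\<^sup>2 + m * M * (ip_norm ip v)\<^sup>2
      - 2 * sqrt (m * M) * (ip_norm ip u * ip_norm ip v)"
    using assms(1,2) by (simp add: power2_diff power_mult_distrib algebra_simps)
  finally show ?thesis using assms by (simp add: field_simps)
qed

end

lemma sum_symmetric_square:
  fixes a :: "nat \<Rightarrow> nat \<Rightarrow> 'a::comm_semiring_1"
  assumes "\<And>i j. a i j = a j i"
  shows "(\<Sum>i=1..n. \<Sum>j=1..n. a i j) = (\<Sum>i=1..n. a i i) + 2 * (\<Sum>j=1..n. \<Sum>i=1..<j. a i j)"
proof (induction n)
  case (Suc n)
  have "(\<Sum>i=1..Suc n. \<Sum>j=1..Suc n. a i j) = (\<Sum>i=1..n. \<Sum>j=1..n. a i j)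
      + ((\<Sum>i=1..n. a i (Suc n)) + (\<Sum>j=1..n. a (Suc n) j) + a (Suc n) (Suc n))"
    by (simp add: sum.distrib algebra_simps)
  also have "(\<Sum>j=1..n. a (Suc n) j) = (\<Sum>i=1..n. a i (Suc n))"
    by (rule sum.cong[OF refl]) (rule assms)
  finally show ?case
    unfolding Suc.IH by (simp add: atLeastLessThanSuc_atLeastAtMost mult_2 algebra_simps)
qed simp

theorem theorem7:
  fixes scale :: "'k::real_or_complex \<Rightarrow> 'h::ab_group_add \<Rightarrow> 'h"
    and ip :: "'h \<Rightarrow> 'h \<Rightarrow> 'k"
    and x :: "nat \<Rightarrow> 'h" and n :: nat and m M :: real
  assumes "inner_product_space scale ip"
    and "n \<ge> 1" and "M \<ge> m" and "m > 0"
  shows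
    "((\<forall>i j. 1 \<le> i \<and> i < j \<and> j \<le> n \<longrightarrow>
         Re_ip ip (scale (of_real M) (x j) - x i) (x i - scale (of_real m) (x j)) \<ge> 0)
      \<longleftrightarrow>
      (\<forall>i j. 1 \<le> i \<and> i < j \<and> j \<le> n \<longrightarrow>
         ip_norm ip (x i - scale (of_real ((M + m) / 2)) (x j)) \<le> 1 / 2 * (M - m) * ip_norm ip (x j)))
     \<and>
     ((\<forall>i j. 1 \<le> i \<and> i < j \<and> j \<le> n \<longrightarrow>
         Re_ip ip (scale (of_real M) (x j) - x i) (x i - scale (of_real m) (x j)) \<ge> 0)
      \<or>
      (\<forall>i j. 1 \<le> i \<and> i < j \<and> j \<le> n \<longrightarrow>
         ip_norm ip (x i - scale (of_real ((M + m) / 2)) (x j)) \<le> 1 / 2 * (M - m) * ip_norm ip (x j))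
      \<longrightarrow>
      2 * sqrt (m * M) / (M + m) * (\<Sum>i=1..n. ip_norm ip (x i))\<^sup>2
        + (sqrt M - sqrt m)\<^sup>2 / (M + m) * (\<Sum>i=1..n. (ip_norm ip (x i))\<^sup>2)
        \<le> (ip_norm ip (\<Sum>i=1..n. x i))\<^sup>2
      \<and>
      (2 * sqrt (m * M) / (M + m) * (\<Sum>i=1..n. ip_norm ip (x i))\<^sup>2
        + (sqrt M - sqrt m)\<^sup>2 / (M + m) * (\<Sum>i=1..n. (ip_norm ip (x i))\<^sup>2)
        = (ip_norm ip (\<Sum>i=1..n. x i))\<^sup>2
       \<longleftrightarrow>
       (\<forall>i j. 1 \<le> i \<and> i < j \<and> j \<le> n \<longrightarrow>
          ip_norm ip (x i) * ip_norm ip (x j)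
            = (M + m) / (2 * sqrt (m * M)) * Re_ip ip (x i) (x j))))"
proof -
  interpret inner_product_space scale ip by fact
  define N where "N i = ip_norm ip (x i)" for i
  define R where "R i j = Re_ip ip (x i) (x j)" for i j
  define c where "c = 2 * sqrt (m * M) / (M + m)"
  have pos: "0 < m" "0 < M" and c: "0 < c" using assms by (simp_all add: c_def)
  let ?close = "\<forall>i j. 1 \<le> i \<and> i < j \<and> j \<le> n \<longrightarrow> (N i)\<^sup>2 + m * M * (N j)\<^sup>2 \<le> (M + m) * R i j"
  let ?lhs = "c * (\<Sum>i=1..n. N i)\<^sup>2 + (sqrt M - sqrt m)\<^sup>2 / (M + m) * (\<Sum>i=1..n. (N i)\<^sup>2)"
  let ?rhs = "(ip_norm ip (\<Sum>i=1..n. x i))\<^sup>2"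

  have coeff: "(sqrt M - sqrt m)\<^sup>2 / (M + m) = 1 - c"
    using pos by (simp add: c_def power2_diff real_sqrt_mult field_simps)

  define d where "d i j = R i j - c * (N i * N j)" for i j
  have "d i j = d j i" for i j
    by (simp add: d_def R_def Re_ip_commute[of "x i"] mult.commute)
  then have "(\<Sum>i=1..n. \<Sum>j=1..n. d i j)
      = (\<Sum>i=1..n. d i i) + 2 * (\<Sum>j=1..n. \<Sum>i=1..<j. d i j)"
    by (rule sum_symmetric_square)
  moreover have "(\<Sum>i=1..n. \<Sum>j=1..n. d i j) = ?rhs - c * (\<Sum>i=1..n. N i)\<^sup>2"
  proof -
    have "?rhs = (\<Sum>i=1..n. \<Sum>j=1..n. R i j)"
      unfolding ip_norm_square Re_ip_sum_left unfolding Re_ip_sum_right R_def ..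
    moreover have "(\<Sum>i=1..n. N i)\<^sup>2 = (\<Sum>i=1..n. \<Sum>j=1..n. N i * N j)"
      by (simp add: power2_eq_square sum_product)
    ultimately show ?thesis
      by (simp add: d_def sum_subtractf sum_distrib_left)
  qed
  moreover have "(\<Sum>i=1..n. d i i) = (1 - c) * (\<Sum>i=1..n. (N i)\<^sup>2)"
    unfolding sum_distrib_left
    by (intro sum.cong refl)
      (simp add: d_def R_def N_def algebra_simps flip: ip_norm_square power2_eq_square)
  ultimately have gap: "?rhs - ?lhs = 2 * (\<Sum>j=1..n. \<Sum>i=1..<j. d i j)"
    unfolding coeff by linarith

  have main: "?lhs \<le> ?rhs \<and>
      (?lhs = ?rhs \<longleftrightarrow> (\<forall>i j. 1 \<le> i \<and> i < j \<and> j \<le> n \<longrightarrow>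
        N i * N j = (M + m) / (2 * sqrt (m * M)) * R i j))" if close: ?close
  proof -
    have d_nonneg: "0 \<le> d i j" if "1 \<le> i" "i < j" "j \<le> n" for i j
      using reverse_Cauchy_Schwarz[OF pos, of "x i" "x j"] close that
      unfolding d_def c_def N_def R_def by auto
    then have "?lhs \<le> ?rhs"
      using gap by (smt (verit, best) sum_nonneg atLeastAtMost_iff atLeastLessThan_iff)
    moreover have "?lhs = ?rhs \<longleftrightarrow> (\<Sum>j=1..n. \<Sum>i=1..<j. d i j) = 0"
      using gap by linarith
    moreover have "\<dots> \<longleftrightarrow> (\<forall>j\<in>{1..n}. (\<Sum>i=1..<j. d i j) = 0)"
      by (intro sum_nonneg_eq_0_iff sum_nonneg) (auto intro: d_nonneg)
    moreover have "(\<Sum>i=1..<j. d i j) = 0 \<longleftrightarrow> (\<forall>i\<in>{1..<j}. d i j = 0)" if "j \<in> {1..n}" for j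
      using that by (intro sum_nonneg_eq_0_iff) (auto intro: d_nonneg)
    moreover have "d i j = 0 \<longleftrightarrow> N i * N j = (M + m) / (2 * sqrt (m * M)) * R i j" for i j
    proof -
      have "(M + m) / (2 * sqrt (m * M)) = 1 / c" by (simp add: c_def)
      moreover have "R i j - c * t = 0 \<longleftrightarrow> t = 1 / c * R i j" for t
        using c by (auto simp: field_simps)
      ultimately show ?thesis by (simp only: d_def)
    qed
    ultimately show ?thesis by (auto simp: Ball_def)
  qed

  show ?thesis
    unfolding Re_ip_nonneg_iff ip_norm_le_iff[OF \<open>m \<le> M\<close>]
    using main unfolding N_def R_def c_def by blast
qed

end
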